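(* $\mathbf{L}=\mathbb{N}\setminus\mathbf{M}$ is $\Pi^0_1$-complete and productive: there is a total computable $\psi$ such that whenever $W_e\subseteq\mathbf{L}$, we have $\psi(e)\in\mathbf{L}\setminus W_e$. Relativised: for every $X\subseteq\mathbb{N}$, $\mathbf{M}^X$ is $\Sigma^{0,X}_1$-complete and $\mathbf{L}^X=\mathbb{N}\setminus\mathbf{M}^X$ is $\Pi^{0,X}_1$-complete and $X$-productive.
   Context: $(\varphi_e)_{e\in\mathbb{N}}$ is a fixed standard acceptable numbering of the unary partial computable functions, $W_e=\operatorname{dom}\varphi_e$, and $\mathbf{M}=\{p\in\mathbb{N}:\varphi_p(0)\!\downarrow=1\}$. For $X\subseteq\mathbb{N}$, $(\varphi^X_e)$ is the standard enumeration of the unary $X$-partial computable functions and $\mathbf{M}^X=\{p:\varphi^X_p(0)\!\downarrow=1\}$. $\Sigma^{0,X}_1$ and $\Pi^{0,X}_1$ are the arithmetical classes relativised to $X$. $X$-productivity is the relativisation of productivity to $X$: with $W^X_e=\operatorname{dom}\varphi^X_e$ in place of $W_e$ (and productive function computable in $X$). *)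

theory Defs
  imports Main "HOL-Library.Nat_Bijection"
begin

text \<open>
  Oracle computability on the natural numbers, in Kleene's style: programs are built from the basic
  functions, an oracle query, composition, primitive recursion and minimisation.  All programs are
  unary; several arguments are passed as one via the Cantor pairing \<^const>\<open>prod_encode\<close>.
\<close>

datatype prog =
    Zero | Succ | Fst | Snd | Query
  | Pairing prog prog | Comp prog prog | PrimRec prog prog | Mu prog

text \<open>Undefined if the search meets an undefined value before the first zero.\<close>

definition minimise :: "(nat \<rightharpoonup> nat) \<Rightarrow> nat option" where
  "minimise f =
     (if \<exists>n. f n = Some 0 \<and> (\<forall>k<n. f k \<noteq> None) then Some (LEAST n. f n = Some 0) else None)"

text \<open>
  On input \<open>\<langle>a, n\<rangle>\<close>, the program \<open>PrimRec p q\<close> computes \<open>h a n\<close>, where \<open>h a 0 = p a\<close> and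
  \<open>h a (k + 1) = q \<langle>a, \<langle>k, h a k\<rangle>\<rangle>\<close>.
\<close>

primrec eval :: "nat set \<Rightarrow> prog \<Rightarrow> nat \<rightharpoonup> nat" where
  "eval X Zero x = Some 0"
| "eval X Succ x = Some (Suc x)"
| "eval X Fst x = Some (fst (prod_decode x))"
| "eval X Snd x = Some (snd (prod_decode x))"
| "eval X Query x = Some (if x \<in> X then 1 else 0)"
| "eval X (Pairing p q) x =
     Option.bind (eval X p x) (\<lambda>a. Option.bind (eval X q x) (\<lambda>b. Some (prod_encode (a, b))))"
| "eval X (Comp p q) x = Option.bind (eval X q x) (eval X p)"
| "eval X (PrimRec p q) x =
     (case prod_decode x of (a, n) \<Rightarrow>
        rec_nat (eval X p a)
          (\<lambda>k r. Option.bind r (\<lambda>v. eval X q (prod_encode (a, prod_encode (k, v))))) n)"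
| "eval X (Mu p) x = minimise (\<lambda>n. eval X p (prod_encode (x, n)))"

definition partial_computable_in :: "nat set \<Rightarrow> (nat \<rightharpoonup> nat) \<Rightarrow> bool" where
  "partial_computable_in X f \<longleftrightarrow> (\<exists>p. f = eval X p)"

definition computable_in :: "nat set \<Rightarrow> (nat \<Rightarrow> nat) \<Rightarrow> bool" where
  "computable_in X f \<longleftrightarrow> partial_computable_in X (\<lambda>x. Some (f x))"

text \<open>Unrelativised notions are those relative to the empty oracle.\<close>

abbreviation computable :: "(nat \<Rightarrow> nat) \<Rightarrow> bool" where
  "computable \<equiv> computable_in {}"

definition computable_rel_in :: "nat set \<Rightarrow> (nat \<Rightarrow> nat \<Rightarrow> bool) \<Rightarrow> bool" where
  "computable_rel_in X R \<longleftrightarrow>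
     computable_in X (\<lambda>z. case prod_decode z of (x, y) \<Rightarrow> if R x y then 1 else 0)"

primrec code :: "prog \<Rightarrow> nat" where
  "code Zero = 0"
| "code Succ = 1"
| "code Fst = 2"
| "code Snd = 3"
| "code Query = 4"
| "code (Pairing p q) = 5 + 4 * prod_encode (code p, code q)"
| "code (Comp p q) = 6 + 4 * prod_encode (code p, code q)"
| "code (PrimRec p q) = 7 + 4 * prod_encode (code p, code q)"
| "code (Mu p) = 8 + 4 * code p"

lemma inj_code: "inj code"
proof (rule injI)
  fix p q show "code p = code q \<Longrightarrow> p = q"
  proof (induction p arbitrary: q)
    case Zero then show ?case by (cases q) auto
  next
    case Succ then show ?case by (cases q) auto
  next
    case Fst then show ?case by (cases q) auto
  next
    case Snd then show ?case by (cases q) auto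
  next
    case Query then show ?case by (cases q) auto
  next
    case (Pairing p1 p2) then show ?case by (cases q) (simp_all, presburger+)
  next
    case (Comp p1 p2) then show ?case by (cases q) (simp_all, presburger+)
  next
    case (PrimRec p1 p2) then show ?case by (cases q) (simp_all, presburger+)
  next
    case (Mu p) then show ?case by (cases q) (simp_all, presburger+)
  qed
qed

lemma surj_code: "\<exists>p. code p = n"
proof (induction n rule: less_induct)
  case (less n)
  show ?case
  proof (cases "n < 5")
    case True
    then have "n = 0 \<or> n = 1 \<or> n = 2 \<or> n = 3 \<or> n = 4" by auto
    then show ?thesis
      by (metis code.simps(1-5))
  next
    case False
    define m where "m = (n - 5) div 4"
    obtain a b where ab: "prod_decode m = (a, b)" by (cases "prod_decode m")
    then have m: "m = prod_encode (a, b)" by (metis prod_decode_inverse)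
    have "m < n" using False by (simp add: m_def)
    then have "a < n" "b < n"
      using le_prod_encode_1[of a b] le_prod_encode_2[of b a] m by linarith+
    with less \<open>m < n\<close> obtain p q r where pqr: "code p = a" "code q = b" "code r = m" by metis
    have "n = 5 + 4 * m \<or> n = 6 + 4 * m \<or> n = 7 + 4 * m \<or> n = 8 + 4 * m"
      using False unfolding m_def by presburger
    then show ?thesis
      using pqr m by (metis code.simps(6-9))
  qed
qed

lemma bij_code: "bij code"
  using inj_code surj_code by (metis bijI surjI)

text \<open>
  The standard enumeration of the unary partial \<open>X\<close>-computable functions: index \<open>e\<close> denotes the
  program with code \<open>e\<close>, independently of \<open>X\<close>.
\<close>

definition phi :: "nat set \<Rightarrow> nat \<Rightarrow> nat \<rightharpoonup> nat" where
  "phi X e = eval X (inv code e)"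

lemma range_phi: "range (phi X) = {f. partial_computable_in X f}"
  using bij_code unfolding phi_def partial_computable_in_def
  by (auto simp: bij_def image_iff) (metis inv_f_f)

text \<open>Acceptability in Rogers' sense: intertranslatable with the standard enumeration.\<close>

definition acceptable :: "(nat \<Rightarrow> nat \<rightharpoonup> nat) \<Rightarrow> bool" where
  "acceptable \<phi> \<longleftrightarrow>
     (\<exists>f. computable f \<and> (\<forall>e. \<phi> e = phi {} (f e))) \<and>
     (\<exists>g. computable g \<and> (\<forall>e. phi {} e = \<phi> (g e)))"

definition Mset :: "(nat \<Rightarrow> nat \<rightharpoonup> nat) \<Rightarrow> nat set" where
  "Mset \<phi> = {p. \<phi> p 0 = Some 1}"

definition Lset :: "(nat \<Rightarrow> nat \<rightharpoonup> nat) \<Rightarrow> nat set" where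
  "Lset \<phi> = UNIV - Mset \<phi>"

definition Sigma1 :: "nat set \<Rightarrow> nat set set" where
  "Sigma1 X = {A. \<exists>R. computable_rel_in X R \<and> A = {x. \<exists>y. R x y}}"

definition Pi1 :: "nat set \<Rightarrow> nat set set" where
  "Pi1 X = {A. \<exists>R. computable_rel_in X R \<and> A = {x. \<forall>y. R x y}}"

definition many_one_reducible :: "nat set \<Rightarrow> nat set \<Rightarrow> bool" (infix \<open>\<le>\<^sub>m\<close> 50) where
  "B \<le>\<^sub>m A \<longleftrightarrow> (\<exists>f. computable f \<and> (\<forall>x. x \<in> B \<longleftrightarrow> f x \<in> A))"

text \<open>
  Reductions are computable without oracle, also when the class \<open>\<C>\<close> is relativised.
\<close>

definition complete_for :: "nat set set \<Rightarrow> nat set \<Rightarrow> bool" where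
  "complete_for \<C> A \<longleftrightarrow> A \<in> \<C> \<and> (\<forall>B\<in>\<C>. B \<le>\<^sub>m A)"

definition productive_in :: "nat set \<Rightarrow> (nat \<Rightarrow> nat \<rightharpoonup> nat) \<Rightarrow> nat set \<Rightarrow> bool" where
  "productive_in X \<phi> A \<longleftrightarrow>
     (\<exists>\<psi>. computable_in X \<psi> \<and> (\<forall>e. dom (\<phi> e) \<subseteq> A \<longrightarrow> \<psi> e \<in> A - dom (\<phi> e)))"

end

theory Submission
  imports Defs
begin

text \<open>
  Membership in \<open>M\<close> is enumerable because a terminating computation is witnessed by a finite set of
  triples (program code, input, output), each locally justified by other members of the set, and
  whether a number codes such a set is decidable in the oracle.  Conversely, \<open>\<exists>y. R x y\<close> is reduced
  to \<open>M\<close> by the program that searches for \<open>y\<close> on the hard-wired input \<open>x\<close>.  Productivity is a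
  diagonal argument: a program can be given its own index and run the \<open>e\<close>-th function on it.
\<close>

abbreviation pfst :: "nat \<Rightarrow> nat" where "pfst z \<equiv> fst (prod_decode z)"
abbreviation psnd :: "nat \<Rightarrow> nat" where "psnd z \<equiv> snd (prod_decode z)"

section \<open>Closure properties of the computable functions\<close>

lemma computable_inI: "(\<And>x. eval X p x = Some (f x)) \<Longrightarrow> computable_in X f"
  unfolding computable_in_def partial_computable_in_def by (metis ext)

lemma computable_in_iff: "computable_in X f \<longleftrightarrow> (\<exists>p. \<forall>x. eval X p x = Some (f x))"
  unfolding computable_in_def partial_computable_in_def by (metis ext)

text \<open>The empty oracle answers every query with 0. Putting \<open>Zero\<close> for
  \<open>Query\<close> builds this answer into the program, which then behaves alike under all
  oracles.\<close>

primrec strip_oracle :: "prog \<Rightarrow> prog" where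
  "strip_oracle Zero = Zero"
| "strip_oracle Succ = Succ"
| "strip_oracle Fst = Fst"
| "strip_oracle Snd = Snd"
| "strip_oracle Query = Zero"
| "strip_oracle (Pairing p q) = Pairing (strip_oracle p) (strip_oracle q)"
| "strip_oracle (Comp p q) = Comp (strip_oracle p) (strip_oracle q)"
| "strip_oracle (PrimRec p q) = PrimRec (strip_oracle p) (strip_oracle q)"
| "strip_oracle (Mu p) = Mu (strip_oracle p)"

lemma eval_strip_oracle: "eval X (strip_oracle p) = eval {} p"
  by (induction p) (rule ext, simp)+

lemma computable_in_mono: "computable f \<Longrightarrow> computable_in X f"
  unfolding computable_in_def partial_computable_in_def by (metis eval_strip_oracle)

primrec num :: "nat \<Rightarrow> prog" where
  "num 0 = Zero"
| "num (Suc n) = Comp Succ (num n)"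

lemma eval_num [simp]: "eval X (num n) x = Some n"
  by (induction n) auto

lemma computable_id: "computable_in X (\<lambda>x. x)"
  by (rule computable_inI[of _ "Pairing Fst Snd"]) simp

lemma computable_const: "computable_in X (\<lambda>_. c)"
  by (rule computable_inI[of _ "num c"]) simp

lemma computable_comp:
  assumes "computable_in X f" "computable_in X g"
  shows "computable_in X (\<lambda>x. f (g x))"
proof -
  obtain p q where "\<And>x. eval X p x = Some (f x)" "\<And>x. eval X q x = Some (g x)"
    using assms unfolding computable_in_iff by blast
  then show ?thesis by (intro computable_inI[of _ "Comp p q"]) simp
qed

lemma computable_Suc: "computable_in X f \<Longrightarrow> computable_in X (\<lambda>x. Suc (f x))"
  by (rule computable_comp[of _ Suc], rule computable_inI[of _ Succ]) simp_all

lemma computable_pfst: "computable_in X f \<Longrightarrow> computable_in X (\<lambda>x. pfst (f x))"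
  by (rule computable_comp[of _ pfst], rule computable_inI[of _ Fst]) simp_all

lemma computable_psnd: "computable_in X f \<Longrightarrow> computable_in X (\<lambda>x. psnd (f x))"
  by (rule computable_comp[of _ psnd], rule computable_inI[of _ Snd]) simp_all

lemma computable_prod_encode:
  assumes "computable_in X f" "computable_in X g"
  shows "computable_in X (\<lambda>x. prod_encode (f x, g x))"
proof -
  obtain p q where "\<And>x. eval X p x = Some (f x)" "\<And>x. eval X q x = Some (g x)"
    using assms unfolding computable_in_iff by blast
  then show ?thesis by (intro computable_inI[of _ "Pairing p q"]) simp
qed

text \<open>The input \<open>z\<close> itself serves as the parameter of the recursion, so base,
  step and number of iterations may all depend on it. Arithmetic, case distinction and bounded
  search are brought into \<open>rec_nat\<close> form to apply this.\<close>

lemma computable_rec_nat: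
  assumes "computable_in X f"
    and "computable_in X (\<lambda>w. g (pfst w) (pfst (psnd w)) (psnd (psnd w)))"
    and "computable_in X n"
  shows "computable_in X (\<lambda>z. rec_nat (f z) (g z) (n z))"
proof -
  obtain p where p: "\<And>x. eval X p x = Some (f x)"
    using assms(1) unfolding computable_in_iff by blast
  obtain q where q: "\<And>w. eval X q w = Some (g (pfst w) (pfst (psnd w)) (psnd (psnd w)))"
    using assms(2) unfolding computable_in_iff by blast
  \<comment> \<open>Both \<open>p\<close> and \<open>q\<close> are total, so the option-valued
    recursion in \<open>eval\<close> never meets \<open>None\<close>.\<close>
  have "rec_nat (eval X p a)
          (\<lambda>k r. Option.bind r (\<lambda>v. eval X q (prod_encode (a, prod_encode (k, v))))) m
        = Some (rec_nat (f a) (g a) m)" for a m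
    by (induction m) (simp_all add: p q)
  then have "computable_in X (\<lambda>z. rec_nat (f (pfst z)) (g (pfst z)) (psnd z))"
    by (intro computable_inI[of _ "PrimRec p q"]) (simp add: case_prod_beta)
  from computable_comp[OF this computable_prod_encode[OF computable_id assms(3)]]
  show ?thesis by simp
qed

lemmas computable_intros =
  computable_id computable_const computable_Suc computable_pfst computable_psnd
  computable_prod_encode computable_rec_nat

lemma computable_add:
  assumes "computable_in X f" "computable_in X g"
  shows "computable_in X (\<lambda>x. f x + g x)"
proof -
  have "m + n = rec_nat m (\<lambda>_. Suc) n" for m n :: nat
    by (induction n) simp_all
  then show ?thesis by (simp only:) (intro computable_intros assms)
qed

lemma computable_mult:
  assumes "computable_in X f" "computable_in X g"
  shows "computable_in X (\<lambda>x. f x * g x)"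
proof -
  have "m * n = rec_nat 0 (\<lambda>_ r. r + m) n" for m n :: nat
    by (induction n) simp_all
  then show ?thesis
    by (simp only:) (intro computable_intros computable_add assms
        computable_comp[OF assms(1)])
qed

lemma computable_diff:
  assumes "computable_in X f" "computable_in X g"
  shows "computable_in X (\<lambda>x. f x - g x)"
proof -
  have pred: "r - 1 = rec_nat 0 (\<lambda>k _. k) r" for r :: nat
    by (cases r) simp_all
  have "m - n = rec_nat m (\<lambda>_ r. r - 1) n" for m n :: nat
    by (induction n) simp_all
  then show ?thesis
    unfolding pred by (simp only:) (intro computable_intros assms)
qed

section \<open>Decidable predicates\<close>

definition decidable_in :: "nat set \<Rightarrow> (nat \<Rightarrow> bool) \<Rightarrow> bool" where
  "decidable_in X P \<longleftrightarrow> computable_in X (\<lambda>z. if P z then 1 else 0)"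

lemma decidable_eq_0:
  assumes "computable_in X f"
  shows "decidable_in X (\<lambda>z. f z = 0)"
proof -
  have "(if n = 0 then 1 else (0::nat)) = rec_nat 1 (\<lambda>_ _. 0) n" for n :: nat
    by (cases n) simp_all
  then show ?thesis
    unfolding decidable_in_def by (simp only:) (intro computable_intros assms)
qed

lemma decidable_not:
  assumes "decidable_in X P"
  shows "decidable_in X (\<lambda>z. \<not> P z)"
proof -
  have "(\<not> P z) = ((if P z then 1 else 0) = (0::nat))" for z by simp
  then show ?thesis
    using assms unfolding decidable_in_def[of _ P] by (simp only: decidable_eq_0)
qed

lemma computable_if:
  assumes "decidable_in X P" "computable_in X f" "computable_in X g"
  shows "computable_in X (\<lambda>z. if P z then f z else g z)"
proof -
  \<comment> \<open>A case distinction is a recursion of length 0 or 1.\<close>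
  have "(if P z then f z else g z) = rec_nat (g z) (\<lambda>_ _. f z) (if P z then 1 else 0)" for z
    by simp
  then show ?thesis
    using assms(1) unfolding decidable_in_def
    by (simp only:) (intro computable_intros assms(2,3) computable_comp[OF assms(2)])
qed

lemma decidable_conj:
  assumes "decidable_in X P" "decidable_in X Q"
  shows "decidable_in X (\<lambda>z. P z \<and> Q z)"
proof -
  have "(if P z \<and> Q z then 1 else 0) = (if P z then if Q z then 1 else 0 else (0::nat))" for z
    by simp
  then show ?thesis
    unfolding decidable_in_def by (simp only:) (intro computable_if computable_const assms)
qed

lemma decidable_disj:
  assumes "decidable_in X P" "decidable_in X Q"
  shows "decidable_in X (\<lambda>z. P z \<or> Q z)"
  using decidable_not[OF decidable_conj[OF assms[THEN decidable_not]]] by simp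

lemma decidable_imp:
  assumes "decidable_in X P" "decidable_in X Q"
  shows "decidable_in X (\<lambda>z. P z \<longrightarrow> Q z)"
  using decidable_disj[OF decidable_not[OF assms(1)] assms(2)] by simp

lemma decidable_eq:
  assumes "computable_in X f" "computable_in X g"
  shows "decidable_in X (\<lambda>z. f z = g z)"
proof -
  \<comment> \<open>Subtraction is truncated, so both differences vanish only for equal
    values.\<close>
  have "(f z = g z) = ((f z - g z) + (g z - f z) = 0)" for z by auto
  then show ?thesis
    by (simp only:) (intro decidable_eq_0 computable_add computable_diff assms)
qed

lemma decidable_bex:
  assumes "computable_in X b" "decidable_in X (\<lambda>w. P (pfst w) (psnd w))"
  shows "decidable_in X (\<lambda>z. \<exists>k<b z. P z k)"
proof -
  have "rec_nat 0 (\<lambda>k r. if P z k then 1 else r) n = (if \<exists>k<n. P z k then 1 else (0::nat))" for z n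
    by (induction n) (auto simp: less_Suc_eq)
  note this[symmetric]
  \<comment> \<open>The step of the recursion receives the triple of input, counter and previous
    value; \<open>P\<close> must be read off its first two components.\<close>
  moreover have P: "decidable_in X (\<lambda>w. P (pfst w) (pfst (psnd w)))"
    using computable_comp[OF assms(2)[unfolded decidable_in_def],
        of "\<lambda>w. prod_encode (pfst w, pfst (psnd w))"]
    unfolding decidable_in_def by (simp add: computable_intros)
  ultimately show ?thesis
    unfolding decidable_in_def[of _ "\<lambda>z. \<exists>k<b z. P z k"]
    by (simp only:) (intro computable_intros computable_if P assms(1))
qed

lemma decidable_ball:
  assumes "computable_in X b" "decidable_in X (\<lambda>w. P (pfst w) (psnd w))"
  shows "decidable_in X (\<lambda>z. \<forall>k<b z. P z k)"
  using decidable_not[OF decidable_bex[OF assms(1) decidable_not[OF assms(2)]]] by simp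

lemma decidable_oracle:
  assumes "computable_in X f"
  shows "decidable_in X (\<lambda>z. f z \<in> X)"
  unfolding decidable_in_def
  by (rule computable_comp[OF _ assms], rule computable_inI[of _ Query]) simp

lemma computable_div2:
  assumes "computable_in X f"
  shows "computable_in X (\<lambda>z. f z div 2)"
proof -
  \<comment> \<open>At stage \<open>k\<close> the value \<open>r\<close> is \<open>k div 2\<close>,
    so \<open>k = r + r\<close> tests whether \<open>k\<close> is even, in which case the quotient
    does not grow.\<close>
  have "n div 2 = rec_nat 0 (\<lambda>k r. if k = r + r then r else Suc r) n" for n :: nat
  proof (induction n)
    case (Suc n)
    have "Suc n div 2 = (if n = n div 2 + n div 2 then n div 2 else Suc (n div 2))"
      by presburger
    then show ?case using Suc by simp
  qed simp
  then show ?thesis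
    by (simp only:) (intro computable_intros computable_if decidable_eq computable_add assms)
qed

text \<open>Membership is the parity of \<open>g z\<close> shifted right by \<open>f z\<close>
  binary places, and the shift is iterated halving.\<close>

lemma decidable_set_decode:
  assumes "computable_in X f" "computable_in X g"
  shows "decidable_in X (\<lambda>z. f z \<in> set_decode (g z))"
proof -
  have shift: "m div 2 ^ n = rec_nat m (\<lambda>_ r. r div 2) n" for m n :: nat
    by (induction n) (simp_all add: power_Suc2 div_mult2_eq del: power_Suc)
  have "odd n \<longleftrightarrow> \<not> n = n div 2 + n div 2" for n :: nat
    by presburger
  then have "n \<in> set_decode m \<longleftrightarrow>
      \<not> m div 2 ^ n = (m div 2 ^ n) div 2 + (m div 2 ^ n) div 2" for m n
    unfolding set_decode_def by blast
  then show ?thesis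
    unfolding shift
    by (simp only:) (intro computable_intros decidable_not decidable_eq computable_add
        computable_div2 assms)
qed

lemmas decidable_intros =
  computable_intros computable_add computable_mult decidable_not decidable_conj decidable_disj
  decidable_imp decidable_eq decidable_bex decidable_ball decidable_oracle decidable_set_decode

section \<open>Finite certificates for computations\<close>

text \<open>The disjuncts mirror the clauses of \<open>eval\<close>, with recursive calls replaced
  by membership in \<open>S\<close>. Programs appear as codes, so that the condition can be decided
  on numbers; \<open>d\<close> holds the coded subprograms.\<close>

definition justified :: "nat set \<Rightarrow> (nat \<times> nat \<times> nat) set \<Rightarrow> nat \<Rightarrow> nat \<Rightarrow> nat \<Rightarrow> bool" where
  "justified X S e x v \<longleftrightarrow>
     e = 0 \<and> v = 0 \<or> e = 1 \<and> v = Suc x \<or> e = 2 \<and> v = pfst x \<or> e = 3 \<and> v = psnd x \<or>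
     e = 4 \<and> (x \<in> X \<and> v = 1 \<or> x \<notin> X \<and> v = 0) \<or>
     (\<exists>d. e = 5 + 4 * d \<and> (pfst d, x, pfst v) \<in> S \<and> (psnd d, x, psnd v) \<in> S) \<or>
     (\<exists>d. e = 6 + 4 * d \<and> (\<exists>a. (psnd d, x, a) \<in> S \<and> (pfst d, a, v) \<in> S)) \<or>
     (\<exists>d. e = 7 + 4 * d \<and>
        (psnd x = 0 \<and> (pfst d, pfst x, v) \<in> S \<or>
         (\<exists>k. psnd x = Suc k \<and>
            (\<exists>r. (e, prod_encode (pfst x, k), r) \<in> S \<and>
               (psnd d, prod_encode (pfst x, prod_encode (k, r)), v) \<in> S)))) \<or>
     (\<exists>d. e = 8 + 4 * d \<and> (d, prod_encode (x, v), 0) \<in> S \<and>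
        (\<forall>k<v. \<exists>w. (d, prod_encode (x, k), Suc w) \<in> S))"

definition certificate :: "nat set \<Rightarrow> (nat \<times> nat \<times> nat) set \<Rightarrow> bool" where
  "certificate X S \<longleftrightarrow> (\<forall>(e, x, v)\<in>S. justified X S e x v)"

text \<open>\<open>S\<close> occurs only positively. This is what lets certificates be united and
  extended.\<close>

lemma justified_mono: "justified X S e x v \<Longrightarrow> S \<subseteq> T \<Longrightarrow> justified X T e x v"
  unfolding justified_def by (elim disj_forward ex_forward conj_forward all_forward imp_forward) auto

lemma certificate_Union: "(\<And>S. S \<in> \<A> \<Longrightarrow> certificate X S) \<Longrightarrow> certificate X (\<Union>\<A>)"
  unfolding certificate_def by (fastforce elim: justified_mono)

lemma certificate_insert:
  "certificate X S \<Longrightarrow> justified X S e x v \<Longrightarrow> certificate X (insert (e, x, v) S)"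
  unfolding certificate_def by (fastforce elim: justified_mono)

lemma certificateD: "certificate X S \<Longrightarrow> (e, x, v) \<in> S \<Longrightarrow> justified X S e x v"
  unfolding certificate_def by fast

lemma residues_mod_4_neq:
  "5 + 4 * d \<noteq> 6 + 4 * (d'::nat)" "5 + 4 * d \<noteq> 7 + 4 * (d'::nat)" "5 + 4 * d \<noteq> 8 + 4 * (d'::nat)"
  "6 + 4 * d \<noteq> 7 + 4 * (d'::nat)" "6 + 4 * d \<noteq> 8 + 4 * (d'::nat)" "7 + 4 * d \<noteq> 8 + 4 * (d'::nat)"
  by presburger+

text \<open>The tags 0 to 4 and the residues modulo 4 separate the constructors, so only one
  disjunct survives. Codes stay folded afterwards, which keeps these equations applicable.\<close>

lemma justified_code:
  "justified X S (code Zero) x v \<longleftrightarrow> v = 0"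
  "justified X S (code Succ) x v \<longleftrightarrow> v = Suc x"
  "justified X S (code Fst) x v \<longleftrightarrow> v = pfst x"
  "justified X S (code Snd) x v \<longleftrightarrow> v = psnd x"
  "justified X S (code Query) x v \<longleftrightarrow> v = (if x \<in> X then 1 else 0)"
  "justified X S (code (Pairing p q)) x v \<longleftrightarrow> (code p, x, pfst v) \<in> S \<and> (code q, x, psnd v) \<in> S"
  "justified X S (code (Comp p q)) x v \<longleftrightarrow> (\<exists>a. (code q, x, a) \<in> S \<and> (code p, a, v) \<in> S)"
  "justified X S (code (PrimRec p q)) x v \<longleftrightarrow>
     psnd x = 0 \<and> (code p, pfst x, v) \<in> S \<or>
     (\<exists>k. psnd x = Suc k \<and>
        (\<exists>r. (code (PrimRec p q), prod_encode (pfst x, k), r) \<in> S \<and>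
           (code q, prod_encode (pfst x, prod_encode (k, r)), v) \<in> S))"
  "justified X S (code (Mu p)) x v \<longleftrightarrow>
     (code p, prod_encode (x, v), 0) \<in> S \<and> (\<forall>k<v. \<exists>w. (code p, prod_encode (x, k), Suc w) \<in> S)"
  unfolding justified_def
  by (simp_all add: residues_mod_4_neq residues_mod_4_neq[symmetric])

declare code.simps [simp del]

text \<open>Below the least zero the values are defined and nonzero, hence successors. In this form
  minimisation matches the \<open>Mu\<close> disjunct of \<open>justified\<close>.\<close>

lemma minimise_eq_Some_iff:
  "minimise f = Some n \<longleftrightarrow> f n = Some 0 \<and> (\<forall>k<n. \<exists>w. f k = Some (Suc w))"
proof
  assume *: "minimise f = Some n"
  then obtain m where m: "f m = Some 0" "\<forall>k<m. f k \<noteq> None" and n: "n = (LEAST n. f n = Some 0)"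
    unfolding minimise_def by (auto split: if_splits)
  have "f n = Some 0" and "n \<le> m" and least: "\<And>k. k < n \<Longrightarrow> f k \<noteq> Some 0"
    using m n by (auto intro: LeastI Least_le dest: not_less_Least)
  moreover have "\<exists>w. f k = Some (Suc w)" if "k < n" for k
    using that m(2) least[OF that] \<open>n \<le> m\<close>
    by (metis not0_implies_Suc not_None_eq order_less_le_trans)
  ultimately show "f n = Some 0 \<and> (\<forall>k<n. \<exists>w. f k = Some (Suc w))" by blast
next
  assume *: "f n = Some 0 \<and> (\<forall>k<n. \<exists>w. f k = Some (Suc w))"
  then have "(LEAST n. f n = Some 0) = n"
    by (intro Least_equality) (auto simp: not_less[symmetric])
  moreover have "\<forall>k<n. f k \<noteq> None" using * by auto
  ultimately show "minimise f = Some n" using * unfolding minimise_def by auto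
qed

text \<open>Justifications only refer to subprograms or to smaller recursion arguments, so a certificate
  needs no order on its entries.\<close>

lemma certificate_sound:
  assumes "certificate X S" "(code p, x, v) \<in> S"
  shows "eval X p x = Some v"
  using assms(2)
proof (induction p arbitrary: x v)
  case (Pairing p q)
  from certificateD[OF assms(1) Pairing.prems] show ?case
    using Pairing.IH(1)[of x "pfst v"] Pairing.IH(2)[of x "psnd v"]
    by (simp add: justified_code)
next
  case (Comp p q)
  from certificateD[OF assms(1) Comp.prems] obtain a where "(code q, x, a) \<in> S" "(code p, a, v) \<in> S"
    by (auto simp: justified_code)
  with Comp.IH(2)[of x a] Comp.IH(1)[of a v] show ?case by simp
next
  case (PrimRec p q)
  \<comment> \<open>A justification of \<open>PrimRec p q\<close> refers to the same program at the
    preceding argument, which the hypotheses for \<open>p\<close> and \<open>q\<close> do not cover;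
    hence an inner induction on \<open>n\<close>.\<close>
  have "eval X (PrimRec p q) (prod_encode (a, n)) = Some v"
    if "(code (PrimRec p q), prod_encode (a, n), v) \<in> S" for a n v
    using that
  proof (induction n arbitrary: v)
    case 0
    from certificateD[OF assms(1) 0] show ?case by (simp add: justified_code PrimRec.IH(1))
  next
    case (Suc n)
    from certificateD[OF assms(1) Suc.prems] obtain r where "(code (PrimRec p q), prod_encode (a, n), r) \<in> S"
      "(code q, prod_encode (a, prod_encode (n, r)), v) \<in> S"
      by (auto simp: justified_code)
    with Suc.IH[of r] PrimRec.IH(2) show ?case by simp
  qed
  from this[of "pfst x" "psnd x"] PrimRec.prems show ?case by simp
next
  case (Mu p)
  from certificateD[OF assms(1) Mu.prems] have "(code p, prod_encode (x, v), 0) \<in> S"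
    and "\<forall>k<v. \<exists>w. (code p, prod_encode (x, k), Suc w) \<in> S"
    by (simp_all add: justified_code)
  then show ?case using Mu.IH by (simp add: minimise_eq_Some_iff) blast
qed (use certificateD[OF assms(1)] in \<open>fastforce simp: justified_code\<close>)+

lemma certificate_complete:
  assumes "eval X p x = Some v"
  shows "\<exists>S. finite S \<and> certificate X S \<and> (code p, x, v) \<in> S"
proof -
  \<comment> \<open>Inclusion in some finite certificate is a notion closed under finite unions and
    under adding a justified triple, so the witnesses of subcomputations need not be
    tracked.\<close>
  define certified where
    "certified T \<longleftrightarrow> (\<exists>S. finite S \<and> certificate X S \<and> T \<subseteq> S)" for T
  have empty: "certified {}"
    unfolding certified_def certificate_def by blast
  have step: "certified {(e, x, v)}" if "certified T" "justified X T e x v" for T e x v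
    using that unfolding certified_def
    by (metis certificate_insert finite_insert insert_subset empty_subsetI insertI1 justified_mono)
  \<comment> \<open>Arbitrary finite families are allowed because a \<open>Mu\<close> computation
    with result \<open>v\<close> relies on \<open>v + 1\<close> subcomputations.\<close>
  have union: "certified (\<Union>\<A>)" if fin: "finite \<A>" and cert: "\<And>T. T \<in> \<A> \<Longrightarrow> certified T" for \<A>
  proof -
    obtain F where "\<And>T. T \<in> \<A> \<Longrightarrow> finite (F T) \<and> certificate X (F T) \<and> T \<subseteq> F T"
      using cert unfolding certified_def by metis
    then show ?thesis
      unfolding certified_def using fin
      by (intro exI[of _ "\<Union>(F ` \<A>)"]) (auto intro!: certificate_Union)
  qed
  have "certified {(code p, x, v)}"
    using assms
  proof (induction p arbitrary: x v)
    case (Pairing p q)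
    then obtain a b where ab: "eval X p x = Some a" "eval X q x = Some b" "v = prod_encode (a, b)"
      by (auto simp: bind_eq_Some_conv)
    show ?case
      by (rule step[OF union[of "{{(code p, x, a)}, {(code q, x, b)}}"]])
        (use ab Pairing.IH in \<open>auto simp: justified_code\<close>)
  next
    case (Comp p q)
    then obtain a where a: "eval X q x = Some a" "eval X p a = Some v"
      by (auto simp: bind_eq_Some_conv)
    show ?case
      by (rule step[OF union[of "{{(code q, x, a)}, {(code p, a, v)}}"]])
        (use a Comp.IH in \<open>auto simp: justified_code\<close>)
  next
    case (PrimRec p q)
    have "certified {(code (PrimRec p q), prod_encode (a, n), v)}"
      if "eval X (PrimRec p q) (prod_encode (a, n)) = Some v" for a n v
      using that
    proof (induction n arbitrary: v)
      case 0
      then show ?case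
        by (intro step[OF PrimRec.IH(1)[of a v]]) (simp_all add: justified_code)
    next
      case (Suc n)
      then obtain r where r: "eval X (PrimRec p q) (prod_encode (a, n)) = Some r"
        "eval X q (prod_encode (a, prod_encode (n, r))) = Some v"
        by (auto simp: bind_eq_Some_conv)
      show ?case
        by (rule step[OF union[of "{{(code (PrimRec p q), prod_encode (a, n), r)},
            {(code q, prod_encode (a, prod_encode (n, r)), v)}}"]])
          (use Suc.IH[OF r(1)] PrimRec.IH(2)[OF r(2)] in \<open>auto simp: justified_code\<close>)
    qed
    from this[of "pfst x" "psnd x"] PrimRec.prems show ?case by simp
  next
    case (Mu p)
    then obtain w where w: "eval X p (prod_encode (x, v)) = Some 0"
      "\<And>k. k < v \<Longrightarrow> eval X p (prod_encode (x, k)) = Some (Suc (w k))"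
      by (auto simp: minimise_eq_Some_iff) metis
    show ?case
      by (rule step[OF union[of "insert {(code p, prod_encode (x, v), 0)}
          ((\<lambda>k. {(code p, prod_encode (x, k), Suc (w k))}) ` {..<v})"]])
        (use w Mu.IH in \<open>auto simp: justified_code\<close>)
  qed (auto intro!: step[OF empty] simp: justified_code)
  then show ?thesis unfolding certified_def by auto
qed

section \<open>Enumerability of the evaluation relation\<close>

text \<open>The binary digits of \<open>s\<close> form a bit mask over coded triples. As pairing is
  bijective, every number codes a finite set and no well-formedness test arises.\<close>

definition triples :: "nat \<Rightarrow> (nat \<times> nat \<times> nat) set" where
  "triples s = {(e, x, v). prod_encode (e, prod_encode (x, v)) \<in> set_decode s}"

lemma ex_triples:
  assumes "finite S"
  shows "\<exists>s. triples s = S"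
proof -
  let ?f = "\<lambda>(e, x, v). prod_encode (e, prod_encode (x, v))"
  have "set_decode (set_encode (?f ` S)) = ?f ` S"
    using assms by simp
  moreover have "?f (e, x, v) \<in> ?f ` S \<longleftrightarrow> (e, x, v) \<in> S" for e x v
    by (rule inj_image_mem_iff) (auto intro: injI simp: prod_encode_eq)
  ultimately have "triples (set_encode (?f ` S)) = S"
    unfolding triples_def by auto
  then show ?thesis ..
qed

lemma set_decode_less: "n \<in> set_decode m \<Longrightarrow> n < m"
proof -
  assume "n \<in> set_decode m"
  then have "2 ^ n \<le> m" unfolding set_decode_def
    by (metis div_less even_zero mem_Collect_eq not_less)
  then show "n < m" using less_exp[of n] by linarith
qed

text \<open>A set bit at position n forces s to be at least 2^n > n, and pairing dominates its
  components. Thus \<open>s\<close> bounds every search through \<open>triples s\<close>.\<close>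

lemma triples_bound:
  assumes "(e, x, v) \<in> triples s"
  shows "e < s" "x < s" "v < s"
  using assms set_decode_less[of "prod_encode (e, prod_encode (x, v))" s]
    le_prod_encode_1[of e "prod_encode (x, v)"] le_prod_encode_2[of "prod_encode (x, v)" e]
    le_prod_encode_1[of x v] le_prod_encode_2[of v x]
  unfolding triples_def by simp_all

lemma ex_bounded_cong:
  "(\<And>k. P k \<longleftrightarrow> Q k) \<Longrightarrow> (\<And>k. P k \<Longrightarrow> k < b) \<Longrightarrow> (\<exists>k. P k) \<longleftrightarrow> (\<exists>k<b. Q k)"
  by blast

text \<open>All quantifiers become bounded: \<open>d\<close> by the code \<open>e\<close> built from
  it, \<open>k\<close> by its successor, and \<open>a\<close>, \<open>r\<close>, \<open>w\<close> by
  \<open>s\<close> as parts of entries. The closure rules for decidable predicates then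
  apply.\<close>

lemma justified_triples_bounded:
  "justified X (triples s) e x v \<longleftrightarrow>
     e = 0 \<and> v = 0 \<or> e = 1 \<and> v = Suc x \<or> e = 2 \<and> v = pfst x \<or> e = 3 \<and> v = psnd x \<or>
     e = 4 \<and> (x \<in> X \<and> v = 1 \<or> \<not> x \<in> X \<and> v = 0) \<or>
     (\<exists>d<e. e = 5 + 4 * d \<and> (pfst d, x, pfst v) \<in> triples s \<and> (psnd d, x, psnd v) \<in> triples s) \<or>
     (\<exists>d<e. e = 6 + 4 * d \<and> (\<exists>a<s. (psnd d, x, a) \<in> triples s \<and> (pfst d, a, v) \<in> triples s)) \<or>
     (\<exists>d<e. e = 7 + 4 * d \<and>
        (psnd x = 0 \<and> (pfst d, pfst x, v) \<in> triples s \<or>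
         (\<exists>k<psnd x. psnd x = Suc k \<and>
            (\<exists>r<s. (e, prod_encode (pfst x, k), r) \<in> triples s \<and>
               (psnd d, prod_encode (pfst x, prod_encode (k, r)), v) \<in> triples s)))) \<or>
     (\<exists>d<e. e = 8 + 4 * d \<and> (d, prod_encode (x, v), 0) \<in> triples s \<and>
        (\<forall>k<v. \<exists>w<s. (d, prod_encode (x, k), Suc w) \<in> triples s))"
  unfolding justified_def
  by (intro refl ex_bounded_cong all_cong1 imp_cong arg_cong2[where f = "(\<and>)"]
      arg_cong2[where f = "(\<or>)"]) (auto dest: triples_bound)

lemma decidable_triples:
  assumes "computable_in X e" "computable_in X x" "computable_in X v" "computable_in X s"
  shows "decidable_in X (\<lambda>z. (e z, x z, v z) \<in> triples (s z))"
  unfolding triples_def by (simp, intro decidable_intros assms)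

lemma decidable_justified:
  assumes "computable_in X e" "computable_in X x" "computable_in X v" "computable_in X s"
  shows "decidable_in X (\<lambda>z. justified X (triples (s z)) (e z) (x z) (v z))"
proof -
  \<comment> \<open>First the case where the four arguments are the components of one coded tuple;
    composition gives the general case.\<close>
  have "decidable_in X (\<lambda>z. justified X (triples (psnd (psnd (psnd z))))
      (pfst z) (pfst (psnd z)) (pfst (psnd (psnd z))))"
    unfolding justified_triples_bounded by (intro decidable_intros decidable_triples)
  from computable_comp[OF this[unfolded decidable_in_def],
      of "\<lambda>z. prod_encode (e z, prod_encode (x z, prod_encode (v z, s z)))"]
  show ?thesis
    unfolding decidable_in_def by (simp add: computable_intros assms)
qed

section \<open>The classes \<Sigma>1 and \<Pi>1, and the normal form of evaluation\<close>

lemma computable_rel_in_iff: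
  "computable_rel_in X R \<longleftrightarrow> decidable_in X (\<lambda>z. R (pfst z) (psnd z))"
  unfolding computable_rel_in_def decidable_in_def case_prod_beta ..

lemma Sigma1I:
  assumes "decidable_in X (\<lambda>z. R (pfst z) (psnd z))" "\<And>x. x \<in> A \<longleftrightarrow> (\<exists>y. R x y)"
  shows "A \<in> Sigma1 X"
proof -
  have "A = {x. \<exists>y. R x y}"
    using assms(2) by blast
  then show ?thesis
    using assms(1) unfolding Sigma1_def computable_rel_in_iff by blast
qed

lemma Sigma1_iff_Pi1: "A \<in> Sigma1 X \<longleftrightarrow> UNIV - A \<in> Pi1 X"
proof
  assume "A \<in> Sigma1 X"
  then obtain R where R: "computable_rel_in X R" "A = {x. \<exists>y. R x y}"
    unfolding Sigma1_def by blast
  have "computable_rel_in X (\<lambda>x y. \<not> R x y)"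
    using R(1) unfolding computable_rel_in_iff by (rule decidable_not)
  moreover have "UNIV - A = {x. \<forall>y. \<not> R x y}"
    using R(2) by blast
  ultimately show "UNIV - A \<in> Pi1 X"
    unfolding Pi1_def by blast
next
  assume "UNIV - A \<in> Pi1 X"
  then obtain R where R: "computable_rel_in X R" "UNIV - A = {x. \<forall>y. R x y}"
    unfolding Pi1_def by blast
  have "x \<in> A \<longleftrightarrow> (\<exists>y. \<not> R x y)" for x
    using R(2) by blast
  with R(1) show "A \<in> Sigma1 X"
    unfolding computable_rel_in_iff by (intro Sigma1I[OF decidable_not])
qed

text \<open>A function reducing the complement of \<open>B\<close> to \<open>A\<close> also reduces
  \<open>B\<close> to the complement of \<open>A\<close>.\<close>

lemma complete_for_Compl:
  assumes "complete_for (Sigma1 X) A"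
  shows "complete_for (Pi1 X) (UNIV - A)"
  unfolding complete_for_def
proof (intro conjI ballI)
  show "UNIV - A \<in> Pi1 X"
    using assms unfolding complete_for_def Sigma1_iff_Pi1 by blast
  fix B assume "B \<in> Pi1 X"
  then have "UNIV - B \<in> Sigma1 X"
    by (simp add: Sigma1_iff_Pi1 Diff_Diff_Int)
  then have "UNIV - B \<le>\<^sub>m A"
    using assms unfolding complete_for_def by blast
  then show "B \<le>\<^sub>m UNIV - A"
    unfolding many_one_reducible_def by auto
qed

lemma phi_code: "phi X (code p) = eval X p"
  unfolding phi_def by (simp add: inj_code)

text \<open>A Kleene normal form: one unbounded search for a number \<open>s\<close> whose decidable
  property is to code a certificate containing the triple. The bound on \<open>t\<close> is harmless
  since set bits of \<open>s\<close> lie below \<open>s\<close>.\<close>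

lemma phi_eq_Some_iff:
  "phi X e x = Some v \<longleftrightarrow>
     (\<exists>s. (e, x, v) \<in> triples s \<and>
        (\<forall>t<s. t \<in> set_decode s \<longrightarrow>
          justified X (triples s) (pfst t) (pfst (psnd t)) (psnd (psnd t))))"
proof -
  have "(\<forall>t<s. t \<in> set_decode s \<longrightarrow>
      justified X (triples s) (pfst t) (pfst (psnd t)) (psnd (psnd t))) \<longleftrightarrow>
    certificate X (triples s)"
    (is "?L s \<longleftrightarrow> _") for s
  proof
    assume L: "?L s"
    have "justified X (triples s) e x v" if "(e, x, v) \<in> triples s" for e x v
    proof -
      have t: "prod_encode (e, prod_encode (x, v)) \<in> set_decode s"
        using that unfolding triples_def by simp
      then show ?thesis
        using L[rule_format, OF set_decode_less[OF t] t] by simp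
    qed
    then show "certificate X (triples s)"
      unfolding certificate_def by blast
  next
    assume cert: "certificate X (triples s)"
    have "(pfst t, pfst (psnd t), psnd (psnd t)) \<in> triples s" if "t \<in> set_decode s" for t
      using that unfolding triples_def by simp
    then show "?L s"
      using cert unfolding certificate_def by fast
  qed
  note certificate = this
  obtain p where e: "e = code p"
    using surj_code by metis
  show ?thesis
    unfolding certificate e phi_code
  proof
    assume "eval X p x = Some v"
    from certificate_complete[OF this] obtain S
      where S: "finite S" "certificate X S" "(code p, x, v) \<in> S"
      by blast
    obtain s where "triples s = S"
      using ex_triples[OF S(1)] ..
    with S show "\<exists>s. (code p, x, v) \<in> triples s \<and> certificate X (triples s)"
      by blast
  qed (use certificate_sound in blast)
qed

lemma Sigma1_phi:
  assumes "computable_in X f"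
  shows "{p. phi X (f p) 0 = Some 1} \<in> Sigma1 X"
proof (rule Sigma1I)
  let ?R = "\<lambda>p s. (f p, 0, 1) \<in> triples s \<and>
     (\<forall>t<s. t \<in> set_decode s \<longrightarrow>
       justified X (triples s) (pfst t) (pfst (psnd t)) (psnd (psnd t)))"
  show "p \<in> {p. phi X (f p) 0 = Some 1} \<longleftrightarrow> (\<exists>s. ?R p s)" for p
    unfolding mem_Collect_eq by (rule phi_eq_Some_iff)
  show "decidable_in X (\<lambda>z. ?R (pfst z) (psnd z))"
    by (intro decidable_intros decidable_triples decidable_justified computable_comp[OF assms])
qed

section \<open>Index arithmetic\<close>

text \<open>The \<open>Comp\<close> clause of \<open>code\<close> on indices. Composing with
  \<open>code (num n)\<close> hard-wires the input \<open>n\<close>, which does the work of the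
  s-m-n theorem.\<close>

definition comp_index :: "nat \<Rightarrow> nat \<Rightarrow> nat" where
  "comp_index a b = 6 + 4 * prod_encode (a, b)"

lemma phi_comp_index: "phi X (comp_index a b) x = Option.bind (phi X b x) (phi X a)"
proof -
  obtain p q where "a = code p" "b = code q"
    using surj_code by metis
  then have "comp_index a b = code (Comp p q)"
    by (simp add: comp_index_def code.simps)
  then show ?thesis
    using \<open>a = code p\<close> \<open>b = code q\<close> by (simp add: phi_code)
qed

lemma computable_comp_index:
  "computable_in X f \<Longrightarrow> computable_in X g \<Longrightarrow> computable_in X (\<lambda>x. comp_index (f x) (g x))"
  unfolding comp_index_def by (intro decidable_intros)

lemma phi_code_num: "phi X (code (num n)) = (\<lambda>_. Some n)"
  by (simp add: phi_code fun_eq_iff)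

lemma computable_code_num:
  assumes "computable_in X f"
  shows "computable_in X (\<lambda>x. code (num (f x)))"
proof -
  \<comment> \<open>Here 0 and 1 are the codes of \<open>Zero\<close> and
    \<open>Succ\<close>.\<close>
  have "code (num n) = rec_nat 0 (\<lambda>_ r. comp_index 1 r) n" for n
    by (induction n) (simp_all add: comp_index_def code.simps)
  then show ?thesis
    by (simp only:) (intro computable_intros computable_comp_index assms)
qed

lemmas index_intros = computable_intros computable_comp_index computable_code_num

section \<open>Completeness and productivity\<close>

lemma Sigma1_complete_Mset:
  assumes "computable f" "\<And>e. \<phi> e = phi X (f e)"
    and "computable g" "\<And>e. phi X e = \<phi> (g e)"
  shows "complete_for (Sigma1 X) (Mset \<phi>)"
  unfolding complete_for_def
proof (intro conjI ballI)
  show "Mset \<phi> \<in> Sigma1 X"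
    unfolding Mset_def assms(2) by (rule Sigma1_phi[OF computable_in_mono[OF assms(1)]])
  fix B assume "B \<in> Sigma1 X"
  then obtain R where R: "computable_rel_in X R" and B: "B = {x. \<exists>y. R x y}"
    unfolding Sigma1_def by blast
  \<comment> \<open>The negation makes 0 the value for success, since \<open>Mu\<close> searches for
    a zero.\<close>
  obtain r where r: "\<And>z. eval X r z = Some (if \<not> R (pfst z) (psnd z) then 1 else 0)"
    using decidable_not[OF R[unfolded computable_rel_in_iff]]
    unfolding decidable_in_def computable_in_iff by blast
  \<comment> \<open>The witness found is discarded and 1 returned. The code \<open>q\<close> is a
    constant, so the oracle enters only when the program is run.\<close>
  define q where "q = code (Comp (num 1) (Mu r))"
  have "phi X q x = Some 1 \<longleftrightarrow> (\<exists>y. R x y)" for x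
    unfolding q_def phi_code by (auto simp: r minimise_def bind_eq_Some_conv)
  then have "x \<in> B \<longleftrightarrow> g (comp_index q (code (num x))) \<in> Mset \<phi>" for x
    unfolding B Mset_def mem_Collect_eq assms(4)[symmetric] by (simp add: phi_comp_index phi_code_num)
  moreover have "computable (\<lambda>x. g (comp_index q (code (num x))))"
    by (intro computable_comp[OF assms(3)] index_intros)
  ultimately show "B \<le>\<^sub>m Mset \<phi>"
    unfolding many_one_reducible_def by (intro exI[of _ "\<lambda>x. g (comp_index q (code (num x)))"] conjI allI)
qed

text \<open>The witness \<open>S (d e)\<close> is a fixed point: it indexes a program that runs the \<open>e\<close>-th function on
  \<open>S (d e)\<close> itself and outputs 1 once that halts.\<close>

lemma productive_Lset:
  assumes "computable f" "\<And>e. \<phi> e = phi X (f e)"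
    and "computable g" "\<And>e. phi X e = \<phi> (g e)"
  shows "productive_in X \<phi> (Lset \<phi>)"
proof -
  \<comment> \<open>Self-application: \<open>S x\<close> is a \<phi>-index of the program that
    ignores its input and runs the program with index \<open>x\<close> on \<open>x\<close>.\<close>
  define S where "S x = g (comp_index x (code (num x)))" for x
  have "computable S"
    unfolding S_def by (intro computable_comp[OF assms(3)] index_intros)
  obtain s where s: "\<And>x. eval X s x = Some (S x)"
    using computable_in_mono[OF \<open>computable S\<close>] unfolding computable_in_iff by blast
  \<comment> \<open>On input y this index runs the \<open>e\<close>-th function on
    \<open>S y\<close> and returns 1 if it halts; applying it to itself puts \<open>S (d e)\<close>
    in place of \<open>S y\<close>.\<close>
  define d where "d e = comp_index (code (num 1)) (comp_index (f e) (code s))" for e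
  have "computable (\<lambda>e. S (d e))"
    unfolding d_def by (intro computable_comp[OF \<open>computable S\<close>] index_intros assms(1))
  then have "computable_in X (\<lambda>e. S (d e))"
    by (rule computable_in_mono)
  moreover have self: "\<phi> (S (d e)) 0 = Option.bind (\<phi> e (S (d e))) (\<lambda>_. Some 1)" for e
  proof -
    have "\<phi> (S (d e)) 0 = phi X (d e) (d e)"
      unfolding S_def assms(4)[symmetric] by (simp add: phi_comp_index phi_code_num)
    also have "\<dots> = Option.bind (\<phi> e (S (d e))) (\<lambda>_. Some 1)"
      unfolding assms(2)[of e]
      by (subst d_def) (simp add: phi_comp_index phi_code_num phi_code[of _ s] s
          del: num.simps)
    finally show ?thesis .
  qed
  \<comment> \<open>If \<open>\<phi> e\<close> halted on \<open>S (d e)\<close>, this index would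
    lie in \<open>Mset \<phi>\<close> and also, by assumption, in \<open>Lset \<phi>\<close>. So it
    does not halt, and then \<open>S (d e)\<close> has no value at 0.\<close>
  have "S (d e) \<in> Lset \<phi> - dom (\<phi> e)" if "dom (\<phi> e) \<subseteq> Lset \<phi>" for e
    using that self[of e] by (cases "\<phi> e (S (d e))") (auto simp: Lset_def Mset_def)
  ultimately show ?thesis
    unfolding productive_in_def by (intro exI[of _ "\<lambda>e. S (d e)"] conjI allI impI)
qed

theorem proposition7p2:
  fixes \<phi> :: "nat \<Rightarrow> nat \<rightharpoonup> nat"
  assumes "acceptable \<phi>"
  shows "complete_for (Pi1 {}) (Lset \<phi>) \<and> productive_in {} \<phi> (Lset \<phi>) \<and>
    (\<forall>X. complete_for (Sigma1 X) (Mset (phi X)) \<and>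
         complete_for (Pi1 X) (Lset (phi X)) \<and>
         productive_in X (phi X) (Lset (phi X)))"
proof -
  obtain f g where fg: "computable f" "\<And>e. \<phi> e = phi {} (f e)"
    "computable g" "\<And>e. phi {} e = \<phi> (g e)"
    using assms unfolding acceptable_def by blast
  \<comment> \<open>For \<open>phi X\<close> itself the identity serves as translation in both
    directions.\<close>
  have phi: "complete_for (Sigma1 X) (Mset (phi X))" "productive_in X (phi X) (Lset (phi X))" for X
    using computable_id by (rule Sigma1_complete_Mset productive_Lset; simp)+
  have "complete_for (Pi1 {}) (Lset \<phi>)" "\<And>X. complete_for (Pi1 X) (Lset (phi X))"
    unfolding Lset_def by (intro complete_for_Compl Sigma1_complete_Mset[OF fg] phi(1))+
  with phi productive_Lset[OF fg] show ?thesis by blast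
qed

end
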